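(* Let $\rho>0$, let $1\le K<N=\min(m,n)$, and let a complex $m\times n$ matrix $F=U_F\Sigma_\phi V_F^*$ (singular value decomposition) be given, with singular values $\phi_1\ge\dots\ge\phi_N\ge0$. Let $\mathcal I(A)=\mathcal R_K(A)+\|A-F\|^2$ and let $\mathcal I^{**}$ be its convex envelope. The solution of $$\operatorname{argmin}_{A}\ \mathcal I^{**}(A)+\rho\|A-F\|^2$$ is of the form $A=U_F\Sigma_\alpha V_F^*$, where $\alpha=(\alpha_j)_{j=1}^N$ has the following structure: there exist natural numbers $k_1\le K\le k_2$ and a real number $s>\phi_{k_2}$ such that $$\alpha_j=\begin{cases}\phi_j, & j<k_1,\\ \phi_j-\dfrac{s-\phi_j}{\rho}, & k_1\le j\le k_2,\\ 0,& j>k_2.\end{cases}$$ In particular, $\alpha$ is a decreasing sequence and $\alpha\le\phi$ (that is, $\alpha_j\le\phi_j$ for all $j$). In other words, the proximal operator, which maps $F$ to the solution $A$, is a contraction with respect to the Frobenius norm.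
   Context: $\|\cdot\|$ is the Frobenius norm on complex $m\times n$ matrices. $\mathcal R_K(A)=0$ if $\operatorname{rank}A\le K$ and $\mathcal R_K(A)=+\infty$ otherwise. The convex envelope $\mathcal I^{**}$ of $\mathcal I$ is the largest convex function that is pointwise $\le\mathcal I$ (the Fenchel bi-conjugate of $\mathcal I$). For a sequence $\alpha=(\alpha_j)_{j=1}^N$, $\Sigma_\alpha$ is the $N\times N$ diagonal matrix with diagonal entries $\alpha_1,\dots,\alpha_N$. A singular value decomposition $F=U_F\Sigma_\phi V_F^*$ has $U_F\in\mathbb C^{m\times N}$, $V_F\in\mathbb C^{n\times N}$, $U_F^*U_F=V_F^*V_F=I_N$, and $\phi$ the decreasing sequence of singular values of $F$. "Decreasing" is meant in the weak sense (nonincreasing).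
   Formalization: The strict bound s>φ_{k2} fails for some F (e.g. rank F≤K); it is proved exactly when 0<φ_K≤(1+ρ)φ_{K+1}, and s≥φ_{k2} otherwise. "Contraction" is read as: the solution A has ‖A‖≤‖F‖, since the 1-Lipschitz reading is false. *)

theory Defs
  imports "HOL-Analysis.Analysis"
begin

text \<open>
  The norm of the type \<open>complex ^ 'n ^ 'm\<close> is the Euclidean norm of the vector of Euclidean norms
  of the rows, that is, the Frobenius norm.
\<close>

lemma norm_matrix_eq_Frobenius:
  fixes A :: "complex ^ 'n ^ 'm"
  shows "norm A = sqrt (\<Sum>i\<in>UNIV. \<Sum>j\<in>UNIV. (cmod (A $ i $ j))\<^sup>2)"
  by (simp add: norm_vec_def L2_set_def sum_nonneg)

definition conj_transpose :: "complex ^ 'n ^ 'm \<Rightarrow> complex ^ 'm ^ 'n" where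
  "conj_transpose A = (\<chi> i j. cnj (A $ j $ i))"

text \<open>
  A sequence \<open>a 1, \<dots>, a N\<close> is placed on the diagonal along the order of the index type
  \<open>'k\<close>, where \<open>N = CARD('k)\<close>: the position of \<open>i\<close> in that order is \<open>card {..i}\<close>.
\<close>

definition diag_matrix :: "(nat \<Rightarrow> real) \<Rightarrow> complex ^ ('k :: {finite, linorder}) ^ ('k :: {finite, linorder})" where
  "diag_matrix a = (\<chi> i j. if i = j then of_real (a (card {..i})) else 0)"

definition decreasing_upto :: "nat \<Rightarrow> (nat \<Rightarrow> real) \<Rightarrow> bool" where
  "decreasing_upto N a \<longleftrightarrow> (\<forall>i j. 1 \<le> i \<longrightarrow> i \<le> j \<longrightarrow> j \<le> N \<longrightarrow> a j \<le> a i)"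

text \<open>
  In \<open>is_svd F U \<phi> V\<close> the index type \<open>'k\<close> has \<open>min m n\<close> elements, so that
  \<open>U\<close> and \<open>V\<close> have orthonormal columns but need not be square.
\<close>

definition is_svd ::
  "complex ^ 'n ^ 'm \<Rightarrow> complex ^ ('k :: {finite, linorder}) ^ 'm \<Rightarrow> (nat \<Rightarrow> real)
    \<Rightarrow> complex ^ ('k :: {finite, linorder}) ^ 'n \<Rightarrow> bool" where
  "is_svd F U \<phi> V \<longleftrightarrow>
     CARD('k) = min CARD('m) CARD('n) \<and>
     conj_transpose U ** U = mat 1 \<and> conj_transpose V ** V = mat 1 \<and>
     decreasing_upto CARD('k) \<phi> \<and> (\<forall>j. 1 \<le> j \<longrightarrow> j \<le> CARD('k) \<longrightarrow> 0 \<le> \<phi> j) \<and>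
     F = U ** diag_matrix \<phi> ** conj_transpose V"

text \<open>
  Convexity of an extended-real function is convexity of its epigraph, which avoids sums of the
  form \<open>\<infinity> - \<infinity>\<close>.
\<close>

definition ext_convex :: "('a :: real_vector \<Rightarrow> ereal) \<Rightarrow> bool" where
  "ext_convex f \<longleftrightarrow> convex {(x, r :: real). f x \<le> ereal r}"

definition convex_envelope :: "('a :: real_vector \<Rightarrow> ereal) \<Rightarrow> 'a \<Rightarrow> ereal" where
  "convex_envelope f x = (SUP g \<in> {g. ext_convex g \<and> (\<forall>y. g y \<le> f y)}. g x)"

lemma convex_envelope_le: "convex_envelope f x \<le> f x"
  unfolding convex_envelope_def by (auto intro: SUP_least)

lemma convex_envelope_greatest:
  assumes "ext_convex g" and "\<And>y. g y \<le> f y"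
  shows "g x \<le> convex_envelope f x"
  unfolding convex_envelope_def using assms by (auto intro: SUP_upper)

lemma ext_convex_convex_envelope: "ext_convex (convex_envelope f)"
proof -
  have "{(x, r :: real). convex_envelope f x \<le> ereal r} =
    (\<Inter>g \<in> {g. ext_convex g \<and> (\<forall>y. g y \<le> f y)}. {(x, r :: real). g x \<le> ereal r})"
    unfolding convex_envelope_def by (auto simp: SUP_le_iff)
  then show ?thesis
    unfolding ext_convex_def by (auto intro!: convex_INT simp: ext_convex_def)
qed

definition rank_penalty :: "nat \<Rightarrow> complex ^ 'n ^ 'm \<Rightarrow> ereal" where
  "rank_penalty K A = (if rank A \<le> K then 0 else \<infinity>)"

definition rank_fit :: "nat \<Rightarrow> complex ^ 'n ^ 'm \<Rightarrow> complex ^ 'n ^ 'm \<Rightarrow> ereal" where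
  "rank_fit K F A = rank_penalty K A + ereal ((norm (A - F))\<^sup>2)"

definition prox_objective ::
  "nat \<Rightarrow> real \<Rightarrow> complex ^ 'n ^ 'm \<Rightarrow> complex ^ 'n ^ 'm \<Rightarrow> ereal" where
  "prox_objective K \<rho> F A =
     convex_envelope (rank_fit K F) A + ereal (\<rho> * (norm (A - F))\<^sup>2)"

text \<open>
  The matrix \<open>F\<close> enters both as the data of the fit and as the centre of the proximal term.
\<close>

definition prox_op :: "nat \<Rightarrow> real \<Rightarrow> complex ^ 'n ^ 'm \<Rightarrow> complex ^ 'n ^ 'm" where
  "prox_op K \<rho> F = arg_min (prox_objective K \<rho> F) (\<lambda>_. True)"

end

theory Submission
  imports Defs
begin

text \<open>
  Expanding the square turns the objective into a convex part \<open>\<I>\<^sup>*\<^sup>*\<close> plus a strictly convex quadratic, so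
  the minimiser \<open>A\<close> is pinned down by one tangent plane of \<open>\<I>\<^sup>*\<^sup>*\<close> whose slope cancels the gradient of
  the quadratic there. That slope is \<open>2 (Z - F)\<close> with \<open>Z = (1 + \<rho>) F - \<rho> A\<close>, and the whole proof consists
  of finding \<open>A\<close> such that the plane of slope \<open>2 (Z - F)\<close> lying below \<open>\<I>\<close> touches \<open>\<I>\<^sup>*\<^sup>*\<close> at \<open>A\<close>.

  The plane lies below \<open>\<I>\<close> by an Eckart--Young estimate for the singular values \<open>z\<close> of \<open>Z\<close>: a matrix of
  rank at most \<open>K\<close> has a row space spanned by at most \<open>K\<close> orthonormal vectors, on which, by two
  applications of Bessel's inequality, \<open>Z\<close> can carry at most the \<open>K\<close> largest of the \<open>z\<^sub>j\<^sup>2\<close>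
  (\<open>low_rank_inner_le\<close>). For any threshold \<open>s\<close>, the number \<open>K s\<^sup>2 + \<Sum>\<^sub>j max 0 (z\<^sub>j\<^sup>2 - s\<^sup>2)\<close> bounds the sum of
  these largest squares, with equality when \<open>s\<close> separates the \<open>K\<close> largest from the rest; stating the
  bound in this form removes all sorting from the argument.

  The plane touches \<open>\<I>\<^sup>*\<^sup>*\<close> at averages of best rank-\<open>K\<close> approximations of \<open>Z\<close>. Keeping the singular values
  of \<open>Z\<close> in a set \<open>S\<close> of \<open>K\<close> positions gives a matrix on which \<open>\<I>\<close> is affine in the indicator of \<open>S\<close>, and
  the weights \<open>t \<in> [0, 1]\<^sup>N\<close> of sum \<open>K\<close> are exactly the averages of such indicators
  (\<open>hypersimplex_induct\<close>), so \<open>\<I>\<^sup>*\<^sup>*\<close> is bounded from above at the matrix with singular values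
  \<open>t\<^sub>j z\<^sub>j\<close> (\<open>convex_envelope_rank_fit_le\<close>). The two bounds agree when \<open>t\<^sub>j = 1\<close> for \<open>z\<^sub>j > s\<close> and \<open>t\<^sub>j = 0\<close> for
  \<open>z\<^sub>j < s\<close> (\<open>prox_objective_arg_min\<close>).

  What remains is scalar. The requirement \<open>t\<^sub>j z\<^sub>j = \<alpha>\<^sub>j\<close> with \<open>z\<^sub>j = (1 + \<rho>) \<phi>\<^sub>j - \<rho> \<alpha>\<^sub>j\<close> forces \<open>z\<^sub>j\<close> to be \<open>s\<close>
  clamped to the interval \<open>[\<phi>\<^sub>j, (1 + \<rho>) \<phi>\<^sub>j]\<close>, and \<open>s\<close> is chosen so that the weights add up to \<open>K\<close>. If
  \<open>(1 + \<rho>) \<phi>\<^bsub>K+1\<^esub> < \<phi>\<^sub>K\<close> or \<open>\<phi>\<^sub>K = 0\<close>, truncating \<open>F\<close> to its first \<open>K\<close> singular values is optimal and \<open>s = \<phi>\<^sub>K\<close>;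
  otherwise the total weight passes through \<open>K\<close> for some \<open>s\<close> between \<open>\<phi>\<^sub>K\<close> and \<open>(1 + \<rho>) \<phi>\<^bsub>K+1\<^esub>\<close>
  (\<open>sum_weight_eq\<close>). Since \<open>0 \<le> \<alpha>\<^sub>j \<le> \<phi>\<^sub>j\<close>, the minimiser has norm at most that of \<open>F\<close>.
\<close>

section \<open>The Hermitian inner product and orthonormal families\<close>

definition cinner :: "complex ^ 'n \<Rightarrow> complex ^ 'n \<Rightarrow> complex" where
  "cinner x y = (\<Sum>i\<in>UNIV. x $ i * cnj (y $ i))"

lemma cinner_add_left: "cinner (x + y) z = cinner x z + cinner y z"
  by (simp add: cinner_def algebra_simps sum.distrib)

lemma cinner_diff_left: "cinner (x - y) z = cinner x z - cinner y z"
  by (simp add: cinner_def algebra_simps sum_subtractf)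

lemma cinner_scale_left: "cinner (c *s x) z = c * cinner x z"
  by (simp add: cinner_def sum_distrib_left mult.assoc)

lemma cinner_scale_right: "cinner x (c *s z) = cnj c * cinner x z"
  by (simp add: cinner_def sum_distrib_left algebra_simps)

lemma cinner_sum_left: "cinner (\<Sum>i\<in>I. f i) z = (\<Sum>i\<in>I. cinner (f i) z)"
  by (induction I rule: infinite_finite_induct) (simp_all add: cinner_add_left, simp_all add: cinner_def)

lemma cinner_commute: "cinner x y = cnj (cinner y x)"
  by (simp add: cinner_def mult.commute)

lemma norm_cinner_commute: "cmod (cinner x y) = cmod (cinner y x)"
  by (subst cinner_commute) simp

lemma cinner_sum_right: "cinner z (\<Sum>i\<in>I. f i) = (\<Sum>i\<in>I. cinner z (f i))"
  by (subst cinner_commute, simp add: cinner_sum_left, simp flip: cinner_commute)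

lemma cinner_zero_left [simp]: "cinner 0 y = 0"
  by (simp add: cinner_def)

lemma Re_cinner: "Re (cinner x y) = x \<bullet> y"
  by (simp add: cinner_def inner_vec_def inner_complex_def)

lemma cinner_self: "cinner x x = of_real ((norm x)\<^sup>2)"
  by (rule complex_eqI) (simp_all add: Re_cinner power2_norm_eq_inner, simp add: cinner_def)

definition orthonormal_family :: "'i set \<Rightarrow> ('i \<Rightarrow> complex ^ 'n) \<Rightarrow> bool" where
  "orthonormal_family I e \<longleftrightarrow>
     finite I \<and> (\<forall>i\<in>I. \<forall>j\<in>I. cinner (e i) (e j) = (if i = j then 1 else 0))"

lemma orthonormal_familyD:
  "orthonormal_family I e \<Longrightarrow> i \<in> I \<Longrightarrow> j \<in> I \<Longrightarrow> cinner (e i) (e j) = (if i = j then 1 else 0)"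
  by (simp add: orthonormal_family_def)

lemma orthonormal_family_finite: "orthonormal_family I e \<Longrightarrow> finite I"
  by (simp add: orthonormal_family_def)

lemma norm_orthonormal_family:
  assumes "orthonormal_family I e" "i \<in> I"
  shows "norm (e i) = 1"
proof -
  have "complex_of_real ((norm (e i))\<^sup>2) = 1"
    using orthonormal_familyD[OF assms(1) assms(2) assms(2)] by (simp add: cinner_self)
  then have "(norm (e i))\<^sup>2 = 1"
    using of_real_eq_1_iff by blast
  then show ?thesis
    using power2_eq_1_iff[of "norm (e i)"] norm_ge_zero[of "e i"] by auto
qed

lemma cinner_orthonormal_sum:
  assumes "orthonormal_family I e" "j \<in> I"
  shows "cinner (\<Sum>i\<in>I. c i *s e i) (e j) = c j"
proof -
  have "cinner (\<Sum>i\<in>I. c i *s e i) (e j) = (\<Sum>i\<in>I. if i = j then c i else 0)"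
    unfolding cinner_sum_left
    by (rule sum.cong) (auto simp: cinner_scale_left orthonormal_familyD[OF assms(1) _ assms(2)])
  then show ?thesis
    using assms orthonormal_family_finite[OF assms(1)] by simp
qed

lemma norm_sq_orthonormal_sum:
  assumes "orthonormal_family I e"
  shows "(norm (\<Sum>i\<in>I. c i *s e i))\<^sup>2 = (\<Sum>i\<in>I. (cmod (c i))\<^sup>2)"
proof -
  have "cinner (\<Sum>i\<in>I. c i *s e i) (\<Sum>i\<in>I. c i *s e i) = (\<Sum>j\<in>I. cnj (c j) * c j)"
    by (simp add: cinner_sum_right cinner_scale_right cinner_orthonormal_sum[OF assms])
  also have "\<dots> = of_real (\<Sum>i\<in>I. (cmod (c i))\<^sup>2)"
    by (simp add: complex_norm_square mult.commute del: of_real_power)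
  finally show ?thesis
    unfolding cinner_self of_real_eq_iff .
qed

text \<open>
  The squared distance from \<open>x\<close> to its projection \<open>p\<close> onto the span is
  \<open>\<parallel>x\<parallel>\<^sup>2 - \<parallel>p\<parallel>\<^sup>2\<close>, and it is nonnegative.
\<close>

lemma Bessel_inequality:
  assumes "orthonormal_family I e"
  shows "(\<Sum>i\<in>I. (cmod (cinner x (e i)))\<^sup>2) \<le> (norm x)\<^sup>2"
proof -
  define p where "p = (\<Sum>i\<in>I. cinner x (e i) *s e i)"
  have "cinner x p = (\<Sum>i\<in>I. cnj (cinner x (e i)) * cinner x (e i))"
    by (simp add: p_def cinner_sum_right cinner_scale_right)
  also have "\<dots> = of_real ((norm p)\<^sup>2)"
    unfolding p_def norm_sq_orthonormal_sum[OF assms] by (simp add: complex_norm_square mult.commute del: of_real_power)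
  finally have "x \<bullet> p = (norm p)\<^sup>2"
    by (metis Re_cinner Re_complex_of_real)
  moreover have "0 \<le> (norm (x - p))\<^sup>2"
    by simp
  ultimately have "(norm p)\<^sup>2 \<le> (norm x)\<^sup>2"
    by (simp add: power2_norm_eq_inner inner_diff_left inner_diff_right inner_commute)
  then show ?thesis
    by (simp add: p_def norm_sq_orthonormal_sum[OF assms])
qed

text \<open>
  The spanning property is expressed by the Fourier expansion, which is how it is used later. A new
  vector \<open>b\<close> contributes its normalised residual against the vectors already found, or nothing
  when that residual vanishes.
\<close>

lemma Gram_Schmidt:
  fixes B :: "(complex ^ 'n) set"
  assumes "finite B"
  shows "\<exists>Q. orthonormal_family Q (\<lambda>q. q) \<and> card Q \<le> card B \<and>
             (\<forall>b\<in>B. b = (\<Sum>q\<in>Q. cinner b q *s q))"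
  using assms
proof (induction B)
  case empty
  show ?case by (intro exI[of _ "{}"]) (simp add: orthonormal_family_def)
next
  case (insert b B)
  then obtain Q where Q: "orthonormal_family Q (\<lambda>q. q)" and card: "card Q \<le> card B"
    and span: "\<forall>b\<in>B. b = (\<Sum>q\<in>Q. cinner b q *s q)" by blast
  have fin: "finite Q" using Q by (rule orthonormal_family_finite)
  define r where "r = b - (\<Sum>q\<in>Q. cinner b q *s q)"
  have orth: "cinner r q = 0" if "q \<in> Q" for q
    using cinner_orthonormal_sum[OF Q that] by (simp add: r_def cinner_diff_left)
  show ?case
  proof (cases "r = 0")
    case True
    then show ?thesis
      using Q card span insert.hyps by (intro exI[of _ Q]) (auto simp: r_def)
  next
    case False
    define e where "e = complex_of_real (1 / norm r) *s r"
    have ee: "cinner e e = 1"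
      using False unfolding e_def cinner_scale_left cinner_scale_right
      by (simp add: cinner_self power2_eq_square)
    have eq: "cinner e q = 0" "cinner q e = 0" if "q \<in> Q" for q
      using orth[OF that] cinner_commute[of q e] by (simp_all add: e_def cinner_scale_left)
    have "e \<notin> Q" using eq(1)[of e] ee by auto
    have re: "r = cinner r e *s e"
      using False by (simp add: e_def cinner_scale_right cinner_self power2_eq_square vec_eq_iff)
    have be: "cinner b e = cinner r e"
      using eq(2) by (simp add: r_def cinner_diff_left cinner_sum_left cinner_scale_left)
    have "orthonormal_family (insert e Q) (\<lambda>q. q)"
      using Q fin ee eq \<open>e \<notin> Q\<close> by (auto simp: orthonormal_family_def)
    moreover have "card (insert e Q) \<le> card (insert b B)"
      using card fin insert.hyps \<open>e \<notin> Q\<close> by simp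
    moreover have "b = (\<Sum>q\<in>insert e Q. cinner b q *s q)"
    proof -
      have "b = r + (\<Sum>q\<in>Q. cinner b q *s q)" by (simp add: r_def)
      also have "\<dots> = (\<Sum>q\<in>insert e Q. cinner b q *s q)"
        using fin \<open>e \<notin> Q\<close> be re by simp
      finally show ?thesis .
    qed
    moreover have "a = (\<Sum>q\<in>insert e Q. cinner a q *s q)" if "a \<in> B" for a
    proof -
      have a: "a = (\<Sum>q\<in>Q. cinner a q *s q)" using span that by blast
      have "cinner a e = 0"
        by (subst a) (simp add: cinner_sum_left cinner_scale_left eq)
      then show ?thesis using fin \<open>e \<notin> Q\<close> a by simp
    qed
    ultimately show ?thesis by (intro exI[of _ "insert e Q"]) auto
  qed
qed

section \<open>Matrices of low rank\<close>

lemma orthonormal_row_basis: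
  fixes A :: "complex ^ 'n ^ 'm"
  obtains Q where "orthonormal_family Q (\<lambda>q. q)" "card Q \<le> rank A"
    "\<And>i. row i A = (\<Sum>q\<in>Q. cinner (row i A) q *s q)"
proof -
  obtain B where B: "B \<subseteq> rows A" "rows A \<subseteq> vec.span B" "card B = vec.dim (rows A)"
    using vec.basis_exists[of "rows A"] by metis
  have "finite B"
    using B(1) finite_subset[of B "rows A"] by (simp add: rows_def full_SetCompr_eq)
  then obtain Q where Q: "orthonormal_family Q (\<lambda>q. q)" "card Q \<le> card B"
    "\<And>b. b \<in> B \<Longrightarrow> b = (\<Sum>q\<in>Q. cinner b q *s q)"
    using Gram_Schmidt by blast
  have "x = (\<Sum>q\<in>Q. cinner x q *s q)" if "x \<in> vec.span B" for x
    using that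
  proof (induction rule: vec.span_induct_alt)
    case base
    show ?case by (simp add: vec_eq_iff)
  next
    case (step c b y)
    have "c *s b + y = c *s (\<Sum>q\<in>Q. cinner b q *s q) + (\<Sum>q\<in>Q. cinner y q *s q)"
      using Q(3)[OF step(1)] step(2) by simp
    also have "\<dots> = (\<Sum>q\<in>Q. cinner (c *s b + y) q *s q)"
      by (simp add: cinner_add_left cinner_scale_left vec.scale_sum_right vec.scale_left_distrib sum.distrib)
    finally show ?case .
  qed
  moreover have "row i A \<in> vec.span B" for i
    using B(2) by (auto simp: rows_def)
  moreover have "card Q \<le> rank A"
    using Q(2) B(3) by (simp add: row_rank_def_gen)
  ultimately show thesis
    using that[OF Q(1)] by simp
qed

text \<open>
  Only the parts of the rows of \<open>Z\<close> along the row space of \<open>A\<close> contribute to the inner product. The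
  case \<open>Z = A\<close> expresses the Frobenius norm of \<open>A\<close> in coordinates.
\<close>

lemma inner_via_row_basis:
  fixes A Z :: "complex ^ 'n ^ 'm"
  assumes "\<And>i. row i A = (\<Sum>q\<in>Q. cinner (row i A) q *s q)"
  shows "A \<bullet> Z = (\<Sum>q\<in>Q. (\<chi> i. cinner (row i A) q) \<bullet> (\<chi> i. cinner (row i Z) q))"
proof -
  have "A $ i \<bullet> Z $ i = (\<Sum>q\<in>Q. cinner (row i A) q \<bullet> cinner (row i Z) q)" for i
  proof -
    have "cinner (row i A) (row i Z) = (\<Sum>q\<in>Q. cinner (row i A) q * cinner q (row i Z))"
      by (subst assms) (simp add: cinner_sum_left cinner_scale_left)
    then have "Re (cinner (row i A) (row i Z)) = (\<Sum>q\<in>Q. Re (cinner (row i A) q * cnj (cinner (row i Z) q)))"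
      by (simp add: cinner_commute[of _ "row i Z"])
    then show ?thesis
      by (simp add: Re_cinner inner_complex_def row_def)
  qed
  then have "A \<bullet> Z = (\<Sum>i\<in>UNIV. \<Sum>q\<in>Q. cinner (row i A) q \<bullet> cinner (row i Z) q)"
    by (simp add: inner_vec_def[of A])
  also have "\<dots> = (\<Sum>q\<in>Q. \<Sum>i\<in>UNIV. cinner (row i A) q \<bullet> cinner (row i Z) q)"
    by (rule sum.swap)
  finally show ?thesis
    by (simp add: inner_vec_def)
qed

text \<open>
  With \<open>u k\<close> the columns of \<open>U\<close> and \<open>w k\<close> the conjugated columns of \<open>V\<close>, this is \<open>U \<Sigma>\<^sub>a V\<^sup>*\<close>. Indexing the
  coefficients by \<open>'k\<close> itself keeps the ordering of the index type out of the matrix arguments.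
\<close>

definition dyad_sum ::
  "('k :: finite \<Rightarrow> complex ^ 'm) \<Rightarrow> ('k \<Rightarrow> complex ^ 'n) \<Rightarrow> ('k \<Rightarrow> real) \<Rightarrow> complex ^ 'n ^ 'm" where
  "dyad_sum u w a = (\<chi> i j. \<Sum>k\<in>UNIV. of_real (a k) * (u k $ i) * (w k $ j))"

lemma row_dyad_sum: "row i (dyad_sum u w a) = (\<Sum>k\<in>UNIV. (of_real (a k) * u k $ i) *s w k)"
  by (simp add: row_def dyad_sum_def vec_eq_iff)

lemma inner_dyad_sum:
  assumes u: "orthonormal_family UNIV u" and w: "orthonormal_family UNIV w"
  shows "dyad_sum u w a \<bullet> dyad_sum u w b = (\<Sum>k\<in>UNIV. a k * b k)"
proof -
  have row_inner: "row i (dyad_sum u w a) \<bullet> row i (dyad_sum u w b)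
      = (\<Sum>k\<in>UNIV. a k * b k * Re (u k $ i * cnj (u k $ i)))" for i
    unfolding Re_cinner[symmetric] row_dyad_sum[of i u w b] cinner_sum_right cinner_scale_right
    unfolding row_dyad_sum cinner_orthonormal_sum[OF w UNIV_I]
    by (auto intro!: sum.cong simp: algebra_simps)
  have "dyad_sum u w a \<bullet> dyad_sum u w b = (\<Sum>i\<in>UNIV. row i (dyad_sum u w a) \<bullet> row i (dyad_sum u w b))"
    by (simp add: inner_vec_def[of "dyad_sum u w a"] row_def)
  also have "\<dots> = (\<Sum>i\<in>UNIV. \<Sum>k\<in>UNIV. a k * b k * Re (u k $ i * cnj (u k $ i)))"
    by (simp only: row_inner)
  also have "\<dots> = (\<Sum>k\<in>UNIV. \<Sum>i\<in>UNIV. a k * b k * Re (u k $ i * cnj (u k $ i)))"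
    by (rule sum.swap)
  also have "\<dots> = (\<Sum>k\<in>UNIV. a k * b k * Re (cinner (u k) (u k)))"
    by (simp only: cinner_def sum_distrib_left Re_sum)
  also have "\<dots> = (\<Sum>k\<in>UNIV. a k * b k)"
    by (simp add: orthonormal_familyD[OF u])
  finally show ?thesis .
qed

lemma norm_sq_dyad_sum:
  assumes "orthonormal_family UNIV u" "orthonormal_family UNIV w"
  shows "(norm (dyad_sum u w a))\<^sup>2 = (\<Sum>k\<in>UNIV. (a k)\<^sup>2)"
  by (simp add: power2_norm_eq_inner inner_dyad_sum[OF assms], simp add: power2_eq_square)

lemma rank_dyad_sum_le:
  fixes u :: "'k :: finite \<Rightarrow> complex ^ 'm" and w :: "'k \<Rightarrow> complex ^ 'n"
  assumes "\<And>k. k \<notin> S \<Longrightarrow> a k = 0"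
  shows "rank (dyad_sum u w a) \<le> card S"
proof -
  have "row i (dyad_sum u w a) \<in> vec.span (w ` S)" for i
  proof -
    have "(of_real (a k) * u k $ i) *s w k \<in> vec.span (w ` S)" for k
      using assms[of k] by (cases "k \<in> S") (auto intro: vec.span_scale vec.span_base simp: vec.span_zero)
    then show ?thesis
      unfolding row_dyad_sum by (rule vec.span_sum)
  qed
  then have "vec.dim (rows (dyad_sum u w a)) \<le> card (w ` S)"
    by (intro vec.dim_le_card) (auto simp: rows_def)
  also have "\<dots> \<le> card S"
    by (simp add: card_image_le)
  finally show ?thesis
    by (simp add: row_rank_def_gen)
qed

text \<open>
  In coordinates along an orthonormal basis \<open>Q\<close> of the row space of \<open>A\<close>, completing the square leaves
  \<open>\<Sum>\<^sub>k z\<^sub>k\<^sup>2 p\<^sub>k\<close> to be bounded, where \<open>p\<^sub>k\<close> is the squared length of the projection of \<open>w k\<close> onto that space.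
  Bessel's inequality for \<open>Q\<close> gives \<open>p\<^sub>k \<le> 1\<close>, and for \<open>w\<close> it gives \<open>\<Sum>\<^sub>k p\<^sub>k \<le> K\<close>; subtracting \<open>s\<^sup>2\<close> from every
  \<open>z\<^sub>k\<^sup>2\<close> uses the second bound once and the first bound for each positive remainder.
\<close>

lemma low_rank_inner_le:
  fixes A :: "complex ^ 'n ^ 'm"
  assumes u: "orthonormal_family UNIV u" and w: "orthonormal_family UNIV w"
    and rank: "rank A \<le> K"
  shows "2 * (A \<bullet> dyad_sum u w z)
    \<le> (norm A)\<^sup>2 + real K * s\<^sup>2 + (\<Sum>k\<in>UNIV. max 0 ((z k)\<^sup>2 - s\<^sup>2))"
proof -
  define Z where "Z = dyad_sum u w z"
  obtain Q where Q: "orthonormal_family Q (\<lambda>q. q)" and cardQ: "card Q \<le> rank A"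
    and rows: "\<And>i. row i A = (\<Sum>q\<in>Q. cinner (row i A) q *s q)"
    by (rule orthonormal_row_basis[of A], rule that)
  define a where "a q = (\<chi> i. cinner (row i A) q)" for q
  define y where "y q = (\<chi> i. cinner (row i Z) q)" for q
  define p where "p k = (\<Sum>q\<in>Q. (cmod (cinner (w k) q))\<^sup>2)" for k
  have y: "(norm (y q))\<^sup>2 = (\<Sum>k\<in>UNIV. (z k)\<^sup>2 * (cmod (cinner (w k) q))\<^sup>2)" for q
  proof -
    have "y q = (\<Sum>k\<in>UNIV. (of_real (z k) * cinner (w k) q) *s u k)"
      unfolding y_def Z_def row_dyad_sum
      by (simp add: vec_eq_iff cinner_sum_left cinner_scale_left algebra_simps)
    then show ?thesis
      by (simp add: norm_sq_orthonormal_sum[OF u] norm_mult power_mult_distrib)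
  qed
  have p1: "p k \<le> 1" for k
    using Bessel_inequality[OF Q, of "w k"] norm_orthonormal_family[OF w, of k] by (simp add: p_def)
  have p0: "0 \<le> p k" for k
    by (simp add: p_def sum_nonneg)
  have psum: "(\<Sum>k\<in>UNIV. p k) \<le> real K"
  proof -
    have "(\<Sum>k\<in>UNIV. p k) = (\<Sum>q\<in>Q. \<Sum>k\<in>UNIV. (cmod (cinner q (w k)))\<^sup>2)"
      unfolding p_def by (subst sum.swap) (simp only: norm_cinner_commute)
    also have "\<dots> \<le> (\<Sum>q\<in>Q. (1::real))"
    proof (rule sum_mono)
      show "(\<Sum>k\<in>UNIV. (cmod (cinner q (w k)))\<^sup>2) \<le> 1" if "q \<in> Q" for q
        using Bessel_inequality[OF w, of q] norm_orthonormal_family[OF Q that] by simp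
    qed
    also have "\<dots> \<le> real K"
      using cardQ rank by simp
    finally show ?thesis .
  qed
  have "(\<Sum>q\<in>Q. (norm (y q))\<^sup>2) = (\<Sum>k\<in>UNIV. (z k)\<^sup>2 * p k)"
    unfolding y p_def sum_distrib_left by (rule sum.swap)
  also have "\<dots> \<le> (\<Sum>k\<in>UNIV. s\<^sup>2 * p k + max 0 ((z k)\<^sup>2 - s\<^sup>2))"
  proof (rule sum_mono)
    fix k
    have "((z k)\<^sup>2 - s\<^sup>2) * p k \<le> max 0 ((z k)\<^sup>2 - s\<^sup>2) * p k"
      by (rule mult_right_mono) (auto simp: p0)
    also have "\<dots> \<le> max 0 ((z k)\<^sup>2 - s\<^sup>2) * 1"
      by (rule mult_left_mono) (auto simp: p1)
    finally show "(z k)\<^sup>2 * p k \<le> s\<^sup>2 * p k + max 0 ((z k)\<^sup>2 - s\<^sup>2)"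
      by (simp add: algebra_simps)
  qed
  also have "\<dots> \<le> real K * s\<^sup>2 + (\<Sum>k\<in>UNIV. max 0 ((z k)\<^sup>2 - s\<^sup>2))"
    using mult_left_mono[OF psum, of "s\<^sup>2"] by (simp add: sum.distrib mult.commute[of "real K"] flip: sum_distrib_left)
  finally have Ysum: "(\<Sum>q\<in>Q. (norm (y q))\<^sup>2) \<le> \<dots>" .
  have "0 \<le> (\<Sum>q\<in>Q. (norm (a q - y q))\<^sup>2)"
    by (simp add: sum_nonneg)
  also have "\<dots> = (\<Sum>q\<in>Q. a q \<bullet> a q) - 2 * (\<Sum>q\<in>Q. a q \<bullet> y q) + (\<Sum>q\<in>Q. (norm (y q))\<^sup>2)"
    by (simp add: power2_norm_eq_inner inner_diff_left inner_diff_right inner_commute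
        sum_distrib_left flip: sum.distrib sum_subtractf)
      (simp add: algebra_simps)
  also have "\<dots> = (norm A)\<^sup>2 - 2 * (A \<bullet> Z) + (\<Sum>q\<in>Q. (norm (y q))\<^sup>2)"
    using inner_via_row_basis[OF rows, of A] inner_via_row_basis[OF rows, of Z]
    by (simp add: a_def y_def power2_norm_eq_inner)
  finally show ?thesis
    using Ysum by (simp add: Z_def)
qed

section \<open>The hypersimplex\<close>

text \<open>
  The vertices of \<open>{t \<in> [0, 1]\<^sup>N. \<Sum> t = K}\<close> are the indicators of the \<open>K\<close>-subsets, stated as an induction rule
  so that \<open>P\<close> can be any property preserved by convex combinations. If \<open>t\<close> has a fractional entry, it
  has a second one, because \<open>K\<close> is an integer. Moving mass between the two in either direction until
  one of them becomes \<open>0\<close> or \<open>1\<close> writes \<open>t\<close> as an average of two points with fewer fractional entries.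
\<close>

lemma hypersimplex_induct [consumes 3, case_names vertex convex]:
  fixes t :: "'k :: finite \<Rightarrow> real"
  assumes "\<And>k. 0 \<le> t k" and "\<And>k. t k \<le> 1" and "(\<Sum>k\<in>UNIV. t k) = real K"
    and vertex: "\<And>S. card S = K \<Longrightarrow> P (\<lambda>k. of_bool (k \<in> S))"
    and convex: "\<And>a b l. P a \<Longrightarrow> P b \<Longrightarrow> 0 \<le> l \<Longrightarrow> l \<le> 1 \<Longrightarrow> P (\<lambda>k. l * a k + (1 - l) * b k)"
  shows "P t"
  using assms(1-3)
proof (induction "card {k. 0 < t k \<and> t k < 1}" arbitrary: t rule: less_induct)
  case less
  define S where "S = {k. t k = 1}"
  define R where "R = {k. 0 < t k \<and> t k < 1}"
  have split: "t k = of_bool (k \<in> S) + (if k \<in> R then t k else 0)" for k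
    using less.prems(1)[of k] less.prems(2)[of k] by (auto simp: S_def R_def)
  have "(\<Sum>k\<in>UNIV. t k) = (\<Sum>k\<in>UNIV. of_bool (k \<in> S) + (if k \<in> R then t k else 0))"
    by (rule sum.cong[OF refl]) (rule split)
  then have "real K = (\<Sum>k\<in>UNIV. of_bool (k \<in> S)) + (\<Sum>k\<in>UNIV. if k \<in> R then t k else 0)"
    unfolding sum.distrib less.prems(3) .
  then have sum_t: "real K = real (card S) + (\<Sum>k\<in>R. t k)"
    by (simp add: sum.inter_restrict[symmetric] sum.If_cases of_bool_def)
  show ?case
  proof (cases "R = {}")
    case True
    have "t = (\<lambda>k. of_bool (k \<in> S))"
    proof
      show "t k = of_bool (k \<in> S)" for k
        using split[of k] True by simp
    qed
    moreover have "card S = K"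
      using sum_t True by simp
    ultimately show ?thesis
      using vertex by simp
  next
    case False
    then obtain k where k: "k \<in> R" by blast
    have "R \<noteq> {k}"
    proof
      assume "R = {k}"
      then have "t k = of_int (int K - int (card S))"
        using sum_t by simp
      with k have "0 < int K - int (card S)" "int K - int (card S) < 1"
        unfolding R_def by auto
      then show False by simp
    qed
    then obtain l where l: "l \<in> R" "l \<noteq> k" using k by blast
    define shift where "shift d = (\<lambda>i. t i + (if i = k then d else 0) - (if i = l then d else 0))" for d
    \<comment> \<open>The largest amounts that can move from entry l to entry k and back.\<close>
    define c where "c = min (1 - t k) (t l)"
    define d where "d = min (t k) (1 - t l)"
    have kl: "0 < t k" "t k < 1" "0 < t l" "t l < 1"
      using k l by (auto simp: R_def)
    have cd: "0 < c" "0 < d"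
      using kl by (auto simp: c_def d_def)
    have shift_sum: "(\<Sum>i\<in>UNIV. shift e i) = real K" for e
      using less.prems(3) by (simp add: shift_def sum.distrib sum_subtractf)
    have P_shift: "P (shift e)"
      if range: "0 \<le> t k + e" "t k + e \<le> 1" "0 \<le> t l - e" "t l - e \<le> 1"
        and hit: "t k + e \<in> {0, 1} \<or> t l - e \<in> {0, 1}" for e
    proof (rule less.hyps)
      have "{i. 0 < shift e i \<and> shift e i < 1} \<subset> R"
      proof (rule psubsetI)
        show "{i. 0 < shift e i \<and> shift e i < 1} \<subseteq> R"
          using k l by (auto simp: shift_def R_def split: if_splits)
        show "{i. 0 < shift e i \<and> shift e i < 1} \<noteq> R"
        proof -
          have "shift e k = t k + e" "shift e l = t l - e"
            using l(2) by (simp_all add: shift_def)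
          then have "k \<notin> {i. 0 < shift e i \<and> shift e i < 1} \<or> l \<notin> {i. 0 < shift e i \<and> shift e i < 1}"
            using hit by auto
          then show ?thesis using k l(1) by blast
        qed
      qed
      then show "card {i. 0 < shift e i \<and> shift e i < 1} < card {k. 0 < t k \<and> t k < 1}"
        unfolding R_def by (intro psubset_card_mono) auto
      show "0 \<le> shift e i" "shift e i \<le> 1" for i
        using range less.prems(1,2)[of i] l(2) by (auto simp: shift_def)
    qed (rule shift_sum)
    have "P (shift c)" "P (shift (- d))"
      using kl by (intro P_shift; auto simp: c_def d_def min_def)+
    then have "P (\<lambda>i. d / (c + d) * shift c i + (1 - d / (c + d)) * shift (- d) i)"
      using cd by (intro convex) auto
    also have "(\<lambda>i. d / (c + d) * shift c i + (1 - d / (c + d)) * shift (- d) i) = t"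
    proof
      fix i
      define m where "m = (if i = k then 1 else 0) - (if i = l then 1 else (0::real))"
      have m: "shift e i = t i + e * m" for e
        by (simp add: shift_def m_def)
      have "(1 - d / (c + d)) = c / (c + d)"
        using cd by (simp add: divide_simps)
      then have "d / (c + d) * shift c i + (1 - d / (c + d)) * shift (- d) i
          = (d * (t i + c * m) + c * (t i - d * m)) / (c + d)"
        by (simp add: m add_divide_distrib)
      also have "d * (t i + c * m) + c * (t i - d * m) = t i * (c + d)"
        by (simp add: algebra_simps)
      finally show "d / (c + d) * shift c i + (1 - d / (c + d)) * shift (- d) i = t i"
        using cd by simp
    qed
    finally show ?thesis .
  qed
qed

section \<open>Bounds for the convex envelope and the minimiser\<close>

lemma ext_convexD:
  assumes "ext_convex g" "g x \<le> ereal r" "g y \<le> ereal q" "0 \<le> l" "l \<le> 1"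
  shows "g (l *\<^sub>R x + (1 - l) *\<^sub>R y) \<le> ereal (l * r + (1 - l) * q)"
  using convexD[OF assms(1)[unfolded ext_convex_def], of "(x, r)" "(y, q)" l "1 - l"] assms(2-)
  by simp

lemma ext_convex_affine:
  fixes B :: "'a :: real_inner"
  shows "ext_convex (\<lambda>A. ereal (A \<bullet> B + c))"
  unfolding ext_convex_def
proof (rule convexI, clarsimp)
  fix x y :: 'a and r q a b :: real
  assume *: "x \<bullet> B + c \<le> r" "y \<bullet> B + c \<le> q" "0 \<le> a" "0 \<le> b" "a + b = 1"
  have "(a *\<^sub>R x + b *\<^sub>R y) \<bullet> B + c = a * (x \<bullet> B + c) + b * (y \<bullet> B + c)"
    using arg_cong[OF *(5), of "\<lambda>m. m * c"] by (simp add: inner_add_left algebra_simps)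
  also have "\<dots> \<le> a * r + b * q"
    using * by (intro add_mono mult_left_mono)
  finally show "(a *\<^sub>R x + b *\<^sub>R y) \<bullet> B + c \<le> a * r + b * q" .
qed

lemma dyad_sum_combination:
  "dyad_sum u w (\<lambda>k. c * a k + d * b k) = c *\<^sub>R dyad_sum u w a + d *\<^sub>R dyad_sum u w b"
proof -
  have "of_real (c * a k + d * b k) * (u k $ i) * (w k $ j)
      = c *\<^sub>R (of_real (a k) * (u k $ i) * (w k $ j)) + d *\<^sub>R (of_real (b k) * (u k $ i) * (w k $ j))"
    for i j k
    by (simp add: scaleR_conv_of_real distrib_right mult.assoc)
  then show ?thesis
    by (simp add: dyad_sum_def vec_eq_iff sum.distrib scaleR_sum_right)
qed

text \<open>
  At a \<open>K\<close>-subset \<open>S\<close> in place of \<open>t\<close> the right-hand side is the value of the rank-constrained fit,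
  because \<open>of_bool\<close> equals its own square. Both the point and the bound are affine in \<open>t\<close>, so
  convexity of the envelope carries the inequality to the whole hypersimplex.
\<close>

lemma convex_envelope_rank_fit_le:
  fixes u :: "'k :: finite \<Rightarrow> complex ^ 'm" and w :: "'k \<Rightarrow> complex ^ 'n"
  assumes u: "orthonormal_family UNIV u" and w: "orthonormal_family UNIV w"
    and "\<And>k. 0 \<le> t k" and "\<And>k. t k \<le> 1" and "(\<Sum>k\<in>UNIV. t k) = real K"
  shows "convex_envelope (rank_fit K (dyad_sum u w f)) (dyad_sum u w (\<lambda>k. t k * z k))
    \<le> ereal ((\<Sum>k\<in>UNIV. (f k)\<^sup>2) + (\<Sum>k\<in>UNIV. t k * ((z k)\<^sup>2 - 2 * z k * f k)))"
  using assms(3-5)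
proof (induction rule: hypersimplex_induct)
  case (vertex S)
  define A where "A = dyad_sum u w (\<lambda>k. of_bool (k \<in> S) * z k)"
  have "A - dyad_sum u w f = dyad_sum u w (\<lambda>k. of_bool (k \<in> S) * z k - f k)"
    using dyad_sum_combination[of u w 1 "\<lambda>k. of_bool (k \<in> S) * z k" "-1" f] by (simp add: A_def)
  then have "(norm (A - dyad_sum u w f))\<^sup>2 = (\<Sum>k\<in>UNIV. (of_bool (k \<in> S) * z k - f k)\<^sup>2)"
    by (simp add: norm_sq_dyad_sum[OF u w])
  also have "\<dots> = (\<Sum>k\<in>UNIV. (f k)\<^sup>2) + (\<Sum>k\<in>UNIV. of_bool (k \<in> S) * ((z k)\<^sup>2 - 2 * z k * f k))"
    unfolding sum.distrib[symmetric] by (rule sum.cong) (auto simp: power2_eq_square algebra_simps)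
  finally have "rank_fit K (dyad_sum u w f) A = ereal \<dots>"
    using rank_dyad_sum_le[of S "\<lambda>k. of_bool (k \<in> S) * z k" u w] vertex
    by (simp add: rank_fit_def rank_penalty_def A_def)
  then show ?case
    using convex_envelope_le[of "rank_fit K (dyad_sum u w f)" A] by (simp add: A_def)
next
  case (convex a b l)
  have point: "dyad_sum u w (\<lambda>k. (l * a k + (1 - l) * b k) * z k)
    = l *\<^sub>R dyad_sum u w (\<lambda>k. a k * z k) + (1 - l) *\<^sub>R dyad_sum u w (\<lambda>k. b k * z k)"
    unfolding dyad_sum_combination[symmetric] by (simp add: algebra_simps)
  have sum: "(\<Sum>k\<in>UNIV. (l * a k + (1 - l) * b k) * ((z k)\<^sup>2 - 2 * z k * f k))
    = l * (\<Sum>k\<in>UNIV. a k * ((z k)\<^sup>2 - 2 * z k * f k))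
      + (1 - l) * (\<Sum>k\<in>UNIV. b k * ((z k)\<^sup>2 - 2 * z k * f k))"
    by (simp add: sum_distrib_left distrib_right mult.assoc flip: sum.distrib)
  show ?case
    using ext_convexD[OF ext_convex_convex_envelope convex(1,2,3,4)]
    unfolding point sum by (simp add: algebra_simps)
qed

text \<open>
  The tangent plane: an affine minorant of the rank-constrained fit is a convex minorant, hence lies
  below the envelope.
\<close>

lemma le_convex_envelope_rank_fit:
  fixes A F :: "complex ^ 'n ^ 'm"
  assumes u: "orthonormal_family UNIV u" and w: "orthonormal_family UNIV w"
  shows "ereal (A \<bullet> (2 *\<^sub>R (dyad_sum u w z - F))
      + ((norm F)\<^sup>2 - real K * s\<^sup>2 - (\<Sum>k\<in>UNIV. max 0 ((z k)\<^sup>2 - s\<^sup>2))))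
    \<le> convex_envelope (rank_fit K F) A"
proof (rule convex_envelope_greatest[OF ext_convex_affine])
  fix B :: "complex ^ 'n ^ 'm"
  show "ereal (B \<bullet> (2 *\<^sub>R (dyad_sum u w z - F))
      + ((norm F)\<^sup>2 - real K * s\<^sup>2 - (\<Sum>k\<in>UNIV. max 0 ((z k)\<^sup>2 - s\<^sup>2)))) \<le> rank_fit K F B"
  proof (cases "rank B \<le> K")
    case True
    have "(norm (B - F))\<^sup>2 = (norm B)\<^sup>2 - 2 * (B \<bullet> F) + (norm F)\<^sup>2"
      by (simp add: power2_norm_eq_inner inner_diff_left inner_diff_right inner_commute)
    then show ?thesis
      using low_rank_inner_le[OF u w True, of z s] True
      by (simp add: rank_fit_def rank_penalty_def inner_diff_right)
  qed (simp add: rank_fit_def rank_penalty_def)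
qed

text \<open>
  The coefficients \<open>z = (1 + \<rho>) f - \<rho> a\<close> make the gradient of the lower bound vanish at the candidate, so
  that the lower bound is its minimum plus \<open>\<rho> \<parallel>A - A\<^sub>0\<parallel>\<^sup>2\<close>. The hypothesis \<open>threshold\<close> says that \<open>t\<close> puts full weight
  where \<open>z\<^sup>2 > s\<^sup>2\<close> and none where \<open>z\<^sup>2 < s\<^sup>2\<close>; it makes the lower bound meet the upper bound at \<open>A\<^sub>0\<close>.
\<close>

lemma prox_objective_arg_min:
  fixes u :: "'k :: finite \<Rightarrow> complex ^ 'm" and w :: "'k \<Rightarrow> complex ^ 'n"
  assumes u: "orthonormal_family UNIV u" and w: "orthonormal_family UNIV w"
    and \<rho>: "0 < \<rho>"
    and t: "\<And>k. 0 \<le> t k" "\<And>k. t k \<le> 1" "(\<Sum>k\<in>UNIV. t k) = real K"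
    and fixpoint: "\<And>k. a k = t k * ((1 + \<rho>) * f k - \<rho> * a k)"
    and threshold: "\<And>k. max 0 (((1 + \<rho>) * f k - \<rho> * a k)\<^sup>2 - s\<^sup>2)
      \<le> t k * (((1 + \<rho>) * f k - \<rho> * a k)\<^sup>2 - s\<^sup>2)"
  shows "{A. is_arg_min (prox_objective K \<rho> (dyad_sum u w f)) (\<lambda>_. True) A} = {dyad_sum u w a}"
proof -
  define z where "z = (\<lambda>k. (1 + \<rho>) * f k - \<rho> * a k)"
  define F where "F = dyad_sum u w f"
  define A0 where "A0 = dyad_sum u w a"
  define Z where "Z = dyad_sum u w z"
  define c where "c = (norm F)\<^sup>2 + (\<Sum>k\<in>UNIV. t k * ((z k)\<^sup>2 - 2 * z k * f k)) + \<rho> * (norm (A0 - F))\<^sup>2"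
  have a: "a = (\<lambda>k. t k * z k)"
    unfolding z_def by (rule ext) (rule fixpoint)
  have "Z = (1 + \<rho>) *\<^sub>R F + (- \<rho>) *\<^sub>R A0"
    unfolding Z_def F_def A0_def dyad_sum_combination[symmetric] z_def by simp
  then have Z: "Z - F = \<rho> *\<^sub>R (F - A0)"
    by (simp add: scaleR_left_distrib scaleR_right_diff_distrib)
  have upper: "prox_objective K \<rho> F A0 \<le> ereal c"
  proof -
    have "convex_envelope (rank_fit K F) A0
        \<le> ereal ((norm F)\<^sup>2 + (\<Sum>k\<in>UNIV. t k * ((z k)\<^sup>2 - 2 * z k * f k)))"
      using convex_envelope_rank_fit_le[OF u w t, of f z]
      by (simp add: F_def A0_def a norm_sq_dyad_sum[OF u w])
    then show ?thesis
      unfolding prox_objective_def c_def plus_ereal.simps(1)[symmetric] by (rule add_right_mono)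
  qed
  \<comment> \<open>The constant of the tangent plane is at most the weighted sum of the squares of z.\<close>
  have S: "real K * s\<^sup>2 + (\<Sum>k\<in>UNIV. max 0 ((z k)\<^sup>2 - s\<^sup>2)) \<le> (\<Sum>k\<in>UNIV. a k * z k)"
  proof -
    have "(\<Sum>k\<in>UNIV. max 0 ((z k)\<^sup>2 - s\<^sup>2)) \<le> (\<Sum>k\<in>UNIV. t k * ((z k)\<^sup>2 - s\<^sup>2))"
      by (rule sum_mono) (use threshold in \<open>simp add: z_def\<close>)
    also have "\<dots> = (\<Sum>k\<in>UNIV. a k * z k) - (\<Sum>k\<in>UNIV. t k) * s\<^sup>2"
      by (simp add: a right_diff_distrib sum_subtractf sum_distrib_right power2_eq_square mult.assoc)
    finally show ?thesis using t(3) by simp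
  qed
  have inners: "A0 \<bullet> A0 = (\<Sum>k\<in>UNIV. a k * a k)" "A0 \<bullet> F = (\<Sum>k\<in>UNIV. a k * f k)"
    by (simp_all add: A0_def F_def inner_dyad_sum[OF u w])
  have az: "(\<Sum>k\<in>UNIV. a k * z k) = (1 + \<rho>) * (A0 \<bullet> F) - \<rho> * (A0 \<bullet> A0)"
    unfolding inners sum_distrib_left sum_subtractf[symmetric]
    by (rule sum.cong) (auto simp: z_def algebra_simps)
  have tz: "(\<Sum>k\<in>UNIV. t k * ((z k)\<^sup>2 - 2 * z k * f k)) = (\<Sum>k\<in>UNIV. a k * z k) - 2 * (A0 \<bullet> F)"
    unfolding inners sum_distrib_left sum_subtractf[symmetric]
    by (rule sum.cong) (auto simp: a power2_eq_square algebra_simps)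
  have lower: "ereal (c + \<rho> * (norm (A - A0))\<^sup>2) \<le> prox_objective K \<rho> F A" for A
  proof -
    define b where "b = (norm F)\<^sup>2 - real K * s\<^sup>2 - (\<Sum>k\<in>UNIV. max 0 ((z k)\<^sup>2 - s\<^sup>2))"
    have "c + \<rho> * (norm (A - A0))\<^sup>2
        = A \<bullet> (2 *\<^sub>R (Z - F)) + ((norm F)\<^sup>2 - (\<Sum>k\<in>UNIV. a k * z k)) + \<rho> * (norm (A - F))\<^sup>2"
      unfolding c_def tz az Z
      by (simp add: power2_norm_eq_inner inner_diff_left inner_diff_right inner_commute algebra_simps)
    also have "\<dots> \<le> A \<bullet> (2 *\<^sub>R (Z - F)) + b + \<rho> * (norm (A - F))\<^sup>2"
      using S by (simp add: b_def)
    finally have "ereal (c + \<rho> * (norm (A - A0))\<^sup>2)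
        \<le> ereal (A \<bullet> (2 *\<^sub>R (Z - F)) + b) + ereal (\<rho> * (norm (A - F))\<^sup>2)"
      by simp
    also have "\<dots> \<le> prox_objective K \<rho> F A"
      unfolding prox_objective_def b_def Z_def
      by (intro add_right_mono le_convex_envelope_rank_fit[OF u w])
    finally show ?thesis .
  qed
  have strict: "prox_objective K \<rho> F A0 < prox_objective K \<rho> F A" if "A \<noteq> A0" for A
  proof -
    have "ereal c < ereal (c + \<rho> * (norm (A - A0))\<^sup>2)"
      using \<rho> that by simp
    then show ?thesis
      using upper lower[of A] by order
  qed
  then have "is_arg_min (prox_objective K \<rho> F) (\<lambda>_. True) A \<longleftrightarrow> A = A0" for A
  proof (cases "A = A0")
    case True
    have "\<not> prox_objective K \<rho> F B < prox_objective K \<rho> F A0" for B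
      using strict[of B] by (cases "B = A0") (simp_all add: not_less less_imp_le)
    then show ?thesis
      using True by (simp add: is_arg_min_def)
  qed (use strict in \<open>auto simp: is_arg_min_def\<close>)
  then show ?thesis
    by (simp add: F_def A0_def)
qed

section \<open>Shrinking a single singular value\<close>

text \<open>
  The three branches of the claimed form of \<open>\<alpha>\<^sub>j\<close> as one expression, nondecreasing in the singular value \<open>x\<close>:
  it is \<open>x\<close> for \<open>x \<ge> s\<close>, the middle formula while \<open>x \<le> s \<le> (1 + \<rho>) x\<close>, and \<open>0\<close> beyond that. Equivalently,
  \<open>(1 + \<rho>) x - \<rho> shrink \<rho> s x\<close> is \<open>s\<close> clamped to \<open>[x, (1 + \<rho>) x]\<close>.
\<close>

definition shrink :: "real \<Rightarrow> real \<Rightarrow> real \<Rightarrow> real" where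
  "shrink \<rho> s x = min x (max 0 (x - (s - x) / \<rho>))"

lemma shrink_mono: "0 < \<rho> \<Longrightarrow> x \<le> y \<Longrightarrow> shrink \<rho> s x \<le> shrink \<rho> s y"
  unfolding shrink_def by (intro min.mono max.mono diff_mono divide_right_mono) auto

lemma shrink_le: "shrink \<rho> s x \<le> x"
  by (simp add: shrink_def)

lemma shrink_nonneg: "0 \<le> x \<Longrightarrow> 0 \<le> shrink \<rho> s x"
  by (simp add: shrink_def)

lemma shrink_above: "0 < \<rho> \<Longrightarrow> 0 \<le> x \<Longrightarrow> s \<le> x \<Longrightarrow> shrink \<rho> s x = x"
proof -
  assume "0 < \<rho>" "0 \<le> x" "s \<le> x"
  then have "(s - x) / \<rho> \<le> 0" by (simp add: divide_nonpos_pos)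
  then show ?thesis using \<open>0 \<le> x\<close> by (simp add: shrink_def)
qed

lemma shrink_between:
  assumes "0 < \<rho>" "x \<le> s" "s \<le> (1 + \<rho>) * x"
  shows "shrink \<rho> s x = x - (s - x) / \<rho>"
proof -
  have "0 \<le> (s - x) / \<rho>" using assms by simp
  moreover have "(s - x) / \<rho> \<le> x" using assms by (simp add: field_simps)
  ultimately show ?thesis by (simp add: shrink_def)
qed

lemma shrink_below:
  assumes "0 < \<rho>" "0 \<le> x" "(1 + \<rho>) * x \<le> s"
  shows "shrink \<rho> s x = 0"
proof -
  have "x \<le> (s - x) / \<rho>" using assms by (simp add: field_simps)
  then show ?thesis using assms(2) by (simp add: shrink_def)
qed

text \<open>
  In the middle range the clamped value is \<open>s\<close>, so the weight has to be \<open>shrink \<rho> s x / s\<close>. Truncating the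
  same quotient to \<open>[0, 1]\<close> gives the right values outside that range and keeps the weight continuous in \<open>s > 0\<close>.
\<close>

definition weight :: "real \<Rightarrow> real \<Rightarrow> real \<Rightarrow> real" where
  "weight \<rho> s x = max 0 (min 1 ((x - (s - x) / \<rho>) / s))"

text \<open>
  The conditions of \<open>prox_objective_arg_min\<close> on one coordinate.
\<close>

definition optimal_weight :: "real \<Rightarrow> real \<Rightarrow> real \<Rightarrow> real \<Rightarrow> bool" where
  "optimal_weight \<rho> s x t \<longleftrightarrow> 0 \<le> t \<and> t \<le> 1 \<and>
     (let z = (1 + \<rho>) * x - \<rho> * shrink \<rho> s x
      in shrink \<rho> s x = t * z \<and> max 0 (z\<^sup>2 - s\<^sup>2) \<le> t * (z\<^sup>2 - s\<^sup>2))"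

lemma optimal_weight_one:
  assumes "0 < \<rho>" "0 \<le> s" "s \<le> x"
  shows "optimal_weight \<rho> s x 1"
proof -
  have "s\<^sup>2 \<le> x\<^sup>2" using assms by (intro power_mono)
  then show ?thesis
    using assms by (simp add: optimal_weight_def shrink_above algebra_simps)
qed

lemma optimal_weight_zero:
  assumes "0 < \<rho>" "0 \<le> x" "(1 + \<rho>) * x \<le> s"
  shows "optimal_weight \<rho> s x 0"
proof -
  have "((1 + \<rho>) * x)\<^sup>2 \<le> s\<^sup>2" using assms by (intro power_mono) auto
  then show ?thesis
    using assms by (simp add: optimal_weight_def shrink_below)
qed

lemma weight_above:
  assumes "0 < \<rho>" "0 < s" "s \<le> x"
  shows "weight \<rho> s x = 1"
proof -
  have "(s - x) / \<rho> \<le> 0" using assms by (simp add: divide_nonpos_pos)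
  then have "1 \<le> (x - (s - x) / \<rho>) / s" using assms by simp
  then show ?thesis by (simp add: weight_def)
qed

lemma weight_below:
  assumes "0 < \<rho>" "0 < s" "(1 + \<rho>) * x \<le> s"
  shows "weight \<rho> s x = 0"
proof -
  have "x \<le> (s - x) / \<rho>" using assms by (simp add: field_simps)
  then have "(x - (s - x) / \<rho>) / s \<le> 0" using assms by (simp add: divide_nonpos_pos)
  then show ?thesis by (simp add: weight_def)
qed

lemma optimal_weight_weight:
  assumes "0 < \<rho>" "0 < s" "0 \<le> x"
  shows "optimal_weight \<rho> s x (weight \<rho> s x)"
proof -
  consider "s \<le> x" | "(1 + \<rho>) * x \<le> s" | "x \<le> s" "s \<le> (1 + \<rho>) * x" by linarith
  then show ?thesis
  proof cases
    case 1
    then show ?thesis using assms by (simp add: weight_above optimal_weight_one)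
  next
    case 2
    then show ?thesis using assms by (simp add: weight_below optimal_weight_zero)
  next
    case 3
    have z: "(1 + \<rho>) * x - \<rho> * shrink \<rho> s x = s"
      using assms by (simp add: shrink_between[OF _ 3] field_simps)
    have "0 \<le> (s - x) / \<rho>" using assms 3 by simp
    moreover have "(s - x) / \<rho> \<le> x" using assms 3 by (simp add: field_simps)
    ultimately have "0 \<le> x - (s - x) / \<rho>" "x - (s - x) / \<rho> \<le> s"
      using 3 by linarith+
    then have "0 \<le> (x - (s - x) / \<rho>) / s" "(x - (s - x) / \<rho>) / s \<le> 1"
      using assms by simp_all
    then have "weight \<rho> s x = (x - (s - x) / \<rho>) / s"
      by (simp add: weight_def)
    then have "shrink \<rho> s x = weight \<rho> s x * s"
      using assms by (simp add: shrink_between[OF _ 3])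
    then show ?thesis
      unfolding optimal_weight_def Let_def z by (simp add: weight_def)
  qed
qed

section \<open>Choosing the threshold\<close>

lemma decreasing_uptoD: "decreasing_upto N f \<Longrightarrow> 1 \<le> i \<Longrightarrow> i \<le> j \<Longrightarrow> j \<le> N \<Longrightarrow> f j \<le> f i"
  by (simp add: decreasing_upto_def)

text \<open>
  At \<open>s = \<phi>\<^sub>K\<close> the first \<open>K\<close> weights are \<open>1\<close>, and at \<open>s = (1 + \<rho>) \<phi>\<^bsub>K+1\<^esub>\<close> all weights after the \<open>K\<close>-th vanish. The total
  weight is continuous in \<open>s\<close>, so it equals \<open>K\<close> somewhere in between.
\<close>

lemma sum_weight_eq:
  fixes \<phi> :: "nat \<Rightarrow> real"
  assumes \<rho>: "0 < \<rho>" and dec: "decreasing_upto N \<phi>" and K: "1 \<le> K" "K < N"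
    and pos: "0 < \<phi> K" and gap: "\<phi> K \<le> (1 + \<rho>) * \<phi> (K + 1)"
  obtains s where "\<phi> K \<le> s" "s \<le> (1 + \<rho>) * \<phi> (K + 1)" "(\<Sum>j=1..N. weight \<rho> s (\<phi> j)) = real K"
proof -
  let ?f = "\<lambda>s. \<Sum>j=1..N. weight \<rho> s (\<phi> j)"
  let ?b = "(1 + \<rho>) * \<phi> (K + 1)"
  have le1: "weight \<rho> s x \<le> 1" and ge0: "0 \<le> weight \<rho> s x" for s x
    by (simp_all add: weight_def)
  have card: "{1..N} \<inter> {j. j \<le> K} = {1..K}"
    using K by auto
  have "?f ?b \<le> (\<Sum>j=1..N. if j \<le> K then 1 else 0)"
  proof (rule sum_mono)
    fix j assume j: "j \<in> {1..N}"
    show "weight \<rho> ?b (\<phi> j) \<le> (if j \<le> K then 1 else 0)"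
    proof (cases "j \<le> K")
      case False
      then have "\<phi> j \<le> \<phi> (K + 1)"
        using j by (intro decreasing_uptoD[OF dec]) auto
      then show ?thesis
        using weight_below[OF \<rho>, of ?b "\<phi> j"] \<rho> pos gap False by simp
    qed (simp add: le1)
  qed
  also have "\<dots> = real K"
    using card by (simp add: sum.If_cases del: One_nat_def)
  finally have fb: "?f ?b \<le> real K" .
  have "real K = (\<Sum>j=1..N. if j \<le> K then 1 else 0)"
    using card by (simp add: sum.If_cases del: One_nat_def)
  also have "\<dots> \<le> ?f (\<phi> K)"
  proof (rule sum_mono)
    fix j assume j: "j \<in> {1..N}"
    show "(if j \<le> K then 1 else 0) \<le> weight \<rho> (\<phi> K) (\<phi> j)"
      using weight_above[OF \<rho> pos, of "\<phi> j"] decreasing_uptoD[OF dec, of j K] K j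
      by (auto simp: ge0)
  qed
  finally have fa: "real K \<le> ?f (\<phi> K)" .
  have "continuous_on {\<phi> K..?b} ?f"
    unfolding weight_def using \<rho> pos by (intro continuous_intros) auto
  then show thesis
    using IVT2'[of ?f ?b "real K" "\<phi> K"] fa fb gap that by blast
qed

text \<open>
  Outside the range of \<open>sum_weight_eq\<close> the threshold \<open>\<phi>\<^sub>K\<close> with \<open>k1 = k2 = K\<close> describes plain truncation; it may
  vanish, and the weights are then given directly because \<open>weight\<close> divides by \<open>s\<close>. Inside that range, \<open>k1\<close>
  and \<open>k2\<close> delimit the indices with \<open>\<phi>\<^sub>j \<le> s \<le> (1 + \<rho>) \<phi>\<^sub>j\<close>.
\<close>

lemma optimal_threshold:
  fixes \<phi> :: "nat \<Rightarrow> real"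
  assumes \<rho>: "0 < \<rho>" and dec: "decreasing_upto N \<phi>"
    and nonneg: "\<And>j. 1 \<le> j \<Longrightarrow> j \<le> N \<Longrightarrow> 0 \<le> \<phi> j"
    and K: "1 \<le> K" "K < N"
  obtains s t k1 k2 where
    "\<And>j. j \<in> {1..N} \<Longrightarrow> optimal_weight \<rho> s (\<phi> j) (t j)"
    "(\<Sum>j=1..N. t j) = real K"
    "1 \<le> k1" "k1 \<le> K" "K \<le> k2" "k2 \<le> N" "\<phi> k2 \<le> s"
    "0 < \<phi> K \<and> \<phi> K \<le> (1 + \<rho>) * \<phi> (K + 1) \<longrightarrow> \<phi> k2 < s"
    "\<And>j. j \<in> {1..N} \<Longrightarrow> shrink \<rho> s (\<phi> j)
      = (if j < k1 then \<phi> j else if j \<le> k2 then \<phi> j - (s - \<phi> j) / \<rho> else 0)"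
proof (cases "0 < \<phi> K \<and> \<phi> K \<le> (1 + \<rho>) * \<phi> (K + 1)")
  case False
  have small: "(1 + \<rho>) * \<phi> j \<le> \<phi> K" if "K < j" "j \<le> N" for j
  proof -
    have "\<phi> j \<le> \<phi> (K + 1)" "\<phi> j \<le> \<phi> K"
      using that K by (auto intro!: decreasing_uptoD[OF dec])
    then have "(1 + \<rho>) * \<phi> j \<le> (1 + \<rho>) * \<phi> (K + 1)" "\<phi> K = 0 \<Longrightarrow> \<phi> j = 0"
      using \<rho> nonneg[of j] K that by auto
    then show ?thesis
      using False nonneg[of K] K by fastforce
  qed
  have big: "\<phi> K \<le> \<phi> j" if "1 \<le> j" "j \<le> K" for j
    using that K by (intro decreasing_uptoD[OF dec]) auto
  show thesis
  proof (rule that[of "\<phi> K" "\<lambda>j. of_bool (j \<le> K)" K K])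
    show "optimal_weight \<rho> (\<phi> K) (\<phi> j) (of_bool (j \<le> K))" if "j \<in> {1..N}" for j
      using that nonneg[of j] nonneg[of K] K small[of j] big[of j]
      by (cases "j \<le> K") (auto intro!: optimal_weight_one optimal_weight_zero \<rho>)
    have "{1..N} \<inter> {j. j \<le> K} = {1..K}"
      using K by auto
    then show "(\<Sum>j=1..N. of_bool (j \<le> K)) = real K"
      by (simp add: of_bool_def sum.If_cases del: One_nat_def)
    show "shrink \<rho> (\<phi> K) (\<phi> j)
        = (if j < K then \<phi> j else if j \<le> K then \<phi> j - (\<phi> K - \<phi> j) / \<rho> else 0)"
      if "j \<in> {1..N}" for j
      using that nonneg[of j] small[of j] big[of j] shrink_above[OF \<rho>, of "\<phi> j" "\<phi> K"]
        shrink_below[OF \<rho>, of "\<phi> j" "\<phi> K"]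
      by (cases j K rule: linorder_cases) auto
  qed (use K False in auto)
next
  case True
  obtain s where s: "\<phi> K \<le> s" "s \<le> (1 + \<rho>) * \<phi> (K + 1)"
    and sum: "(\<Sum>j=1..N. weight \<rho> s (\<phi> j)) = real K"
    using sum_weight_eq[OF \<rho> dec K] True by blast
  have spos: "0 < s" using s True by linarith
  define k1 where "k1 = (LEAST j. 1 \<le> j \<and> \<phi> j \<le> s)"
  define k2 where "k2 = (GREATEST j. j \<le> N \<and> s \<le> (1 + \<rho>) * \<phi> j)"
  have k1: "1 \<le> k1" "\<phi> k1 \<le> s" "k1 \<le> K"
    unfolding k1_def using LeastI[of "\<lambda>j. 1 \<le> j \<and> \<phi> j \<le> s" K] K s
    by (auto intro: Least_le)
  have k1_min: "s < \<phi> j" if "1 \<le> j" "j < k1" for j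
    using not_less_Least[of j "\<lambda>j. 1 \<le> j \<and> \<phi> j \<le> s"] that by (auto simp: k1_def)
  have k2: "k2 \<le> N" "s \<le> (1 + \<rho>) * \<phi> k2"
    using GreatestI_nat[of "\<lambda>j. j \<le> N \<and> s \<le> (1 + \<rho>) * \<phi> j" "K + 1" N] K s
    unfolding k2_def by auto
  have k2_max: "j \<le> k2" if "j \<le> N" "s \<le> (1 + \<rho>) * \<phi> j" for j
    unfolding k2_def by (rule Greatest_le_nat[of _ _ N]) (use that in auto)
  have "K + 1 \<le> k2"
    using k2_max[of "K + 1"] K s by simp
  have "\<phi> k2 \<le> \<phi> (K + 1)" "\<phi> (K + 1) \<le> \<phi> K"
    using K k2(1) \<open>K + 1 \<le> k2\<close> by (auto intro!: decreasing_uptoD[OF dec])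
  \<comment> \<open>Equality would give weight 1 to the first K + 1 indices, more than the total weight K.\<close>
  have "\<phi> k2 \<noteq> s"
  proof
    assume "\<phi> k2 = s"
    then have "s \<le> \<phi> (K + 1)"
      using \<open>\<phi> k2 \<le> \<phi> (K + 1)\<close> by simp
    have "weight \<rho> s (\<phi> j) = 1" if "j \<in> {1..K + 1}" for j
    proof -
      have "\<phi> (K + 1) \<le> \<phi> j" using that K by (intro decreasing_uptoD[OF dec]) auto
      then show ?thesis using \<open>s \<le> \<phi> (K + 1)\<close> by (intro weight_above \<rho> spos) linarith
    qed
    then have "real (K + 1) = (\<Sum>j=1..K + 1. weight \<rho> s (\<phi> j))" by simp
    also have "\<dots> \<le> (\<Sum>j=1..N. weight \<rho> s (\<phi> j))"
      using K by (intro sum_mono2) (auto simp: weight_def)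
    finally show False using sum by simp
  qed
  show thesis
  proof (rule that[of s "\<lambda>j. weight \<rho> s (\<phi> j)" k1 k2])
    show "optimal_weight \<rho> s (\<phi> j) (weight \<rho> s (\<phi> j))" if "j \<in> {1..N}" for j
      using that by (intro optimal_weight_weight \<rho> spos nonneg) auto
    show "shrink \<rho> s (\<phi> j)
        = (if j < k1 then \<phi> j else if j \<le> k2 then \<phi> j - (s - \<phi> j) / \<rho> else 0)"
      if j: "j \<in> {1..N}" for j
    proof -
      consider "j < k1" | "k1 \<le> j" "j \<le> k2" | "k2 < j" by linarith
      then show ?thesis
      proof cases
        case 1
        then have "s < \<phi> j" using k1_min j by auto
        then show ?thesis using 1 spos \<rho> by (simp add: shrink_above)
      next
        case 2
        have "\<phi> j \<le> \<phi> k1" "\<phi> k2 \<le> \<phi> j"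
          using 2 j k1 k2 by (auto intro!: decreasing_uptoD[OF dec])
        then have "\<phi> j \<le> s" "s \<le> (1 + \<rho>) * \<phi> j"
          using k1(2) k2(2) \<rho> mult_left_mono[of "\<phi> k2" "\<phi> j" "1 + \<rho>"] by linarith+
        then show ?thesis using 2 by (simp add: shrink_between[OF \<rho>])
      next
        case 3
        then have "(1 + \<rho>) * \<phi> j \<le> s" using k2_max[of j] j by fastforce
        then show ?thesis
          using 3 j nonneg[of j] k1(3) \<open>K + 1 \<le> k2\<close> by (simp add: shrink_below[OF \<rho>])
      qed
    qed
  qed (use k1 k2 s sum \<open>K + 1 \<le> k2\<close> \<open>\<phi> k2 \<noteq> s\<close> \<open>\<phi> k2 \<le> \<phi> (K + 1)\<close> \<open>\<phi> (K + 1) \<le> \<phi> K\<close> in auto)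
qed

section \<open>From singular value decompositions to sums of dyads\<close>

lemma bij_betw_position:
  "bij_betw (\<lambda>k :: 'k :: {finite, linorder}. card {..k}) UNIV {1..CARD('k)}"
proof -
  have "strict_mono (\<lambda>k :: 'k. card {..k})"
    by (intro strict_monoI psubset_card_mono) auto
  then have inj: "inj (\<lambda>k :: 'k. card {..k})"
    by (rule strict_mono_imp_inj_on)
  have "1 \<le> card {..k}" "card {..k} \<le> CARD('k)" for k :: 'k
    by (auto simp: Suc_le_eq card_gt_0_iff intro: card_mono)
  then have "range (\<lambda>k :: 'k. card {..k}) = {1..CARD('k)}"
    by (intro card_subset_eq) (auto simp: card_image[OF inj])
  with inj show ?thesis
    by (simp add: bij_betw_def)
qed

definition conj_column :: "complex ^ 'k ^ 'n \<Rightarrow> 'k \<Rightarrow> complex ^ 'n" where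
  "conj_column V k = (\<chi> j. cnj (V $ j $ k))"

lemma diag_product_eq_dyad_sum:
  fixes U :: "complex ^ ('k :: {finite, linorder}) ^ 'm" and V :: "complex ^ ('k :: {finite, linorder}) ^ 'n"
  shows "U ** diag_matrix a ** conj_transpose V
    = dyad_sum (\<lambda>k. column k U) (conj_column V) (\<lambda>k. a (card {..k}))"
  by (simp add: vec_eq_iff matrix_matrix_mult_def diag_matrix_def conj_transpose_def dyad_sum_def
      column_def conj_column_def if_distrib[of "\<lambda>x. _ * x"] mult.commute cong: if_cong)

lemma orthonormal_columns:
  fixes U :: "complex ^ ('k :: finite) ^ 'm"
  assumes "conj_transpose U ** U = mat 1"
  shows "orthonormal_family UNIV (\<lambda>k. column k U)"
    and "orthonormal_family UNIV (conj_column U)"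
proof -
  have gram: "(\<Sum>r\<in>UNIV. cnj (U $ r $ i) * U $ r $ j) = (if i = j then 1 else 0)" for i j
    using arg_cong[OF assms, of "\<lambda>M. M $ i $ j"]
    by (simp add: matrix_matrix_mult_def conj_transpose_def mat_def)
  show "orthonormal_family UNIV (\<lambda>k. column k U)"
    using gram by (auto simp: orthonormal_family_def cinner_def column_def mult.commute)
  show "orthonormal_family UNIV (conj_column U)"
    using gram by (auto simp: orthonormal_family_def cinner_def conj_column_def)
qed

theorem theorem3:
  fixes F :: "complex ^ 'n ^ 'm"
    and U :: "complex ^ ('k :: {finite, linorder}) ^ 'm"
    and V :: "complex ^ ('k :: {finite, linorder}) ^ 'n"
    and \<phi> :: "nat \<Rightarrow> real"
    and \<rho> :: real
    and K :: nat
  assumes "\<rho> > 0"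
    and "1 \<le> K" and "K < min CARD('m) CARD('n)"
    and "is_svd F U \<phi> V"
  shows "(\<exists>\<alpha> :: nat \<Rightarrow> real.
            {A. is_arg_min (prox_objective K \<rho> F) (\<lambda>_. True) A} =
              {U ** diag_matrix \<alpha> ** conj_transpose V} \<and>
            (\<exists>k1 k2 s. 1 \<le> k1 \<and> k1 \<le> K \<and> K \<le> k2 \<and> k2 \<le> CARD('k) \<and>
               s \<ge> \<phi> k2 \<and>
               (0 < \<phi> K \<and> \<phi> K \<le> (1 + \<rho>) * \<phi> (K + 1) \<longrightarrow> s > \<phi> k2) \<and>
               (\<forall>j. 1 \<le> j \<longrightarrow> j \<le> CARD('k) \<longrightarrow>
                  \<alpha> j = (if j < k1 then \<phi> j
                         else if j \<le> k2 then \<phi> j - (s - \<phi> j) / \<rho>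
                         else 0))) \<and>
            decreasing_upto CARD('k) \<alpha> \<and>
            (\<forall>j. 1 \<le> j \<longrightarrow> j \<le> CARD('k) \<longrightarrow> \<alpha> j \<le> \<phi> j)) \<and>
         norm (prox_op K \<rho> F) \<le> norm F"
proof -
  define N where "N = CARD('k)"
  define u where "u = (\<lambda>k. column k U)"
  define w where "w = conj_column V"
  note svd = assms(4)[unfolded is_svd_def diag_product_eq_dyad_sum, folded N_def u_def w_def]
  have KN: "K < N"
    using svd assms(3) by simp
  have UV: "conj_transpose U ** U = mat 1" "conj_transpose V ** V = mat 1"
    and dec: "decreasing_upto N \<phi>" and nonneg: "\<And>j. 1 \<le> j \<Longrightarrow> j \<le> N \<Longrightarrow> 0 \<le> \<phi> j"
    and F: "F = dyad_sum u w (\<lambda>k. \<phi> (card {..k}))"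
    using svd by blast+
  have u: "orthonormal_family UNIV u" and w: "orthonormal_family UNIV w"
    unfolding u_def w_def by (rule orthonormal_columns UV)+
  obtain s t k1 k2 where opt: "\<And>j. j \<in> {1..N} \<Longrightarrow> optimal_weight \<rho> s (\<phi> j) (t j)"
    and sum: "(\<Sum>j=1..N. t j) = real K"
    and k12: "1 \<le> k1" "k1 \<le> K" "K \<le> k2" "k2 \<le> N" "\<phi> k2 \<le> s"
      "0 < \<phi> K \<and> \<phi> K \<le> (1 + \<rho>) * \<phi> (K + 1) \<longrightarrow> \<phi> k2 < s"
    and form: "\<And>j. j \<in> {1..N} \<Longrightarrow> shrink \<rho> s (\<phi> j)
      = (if j < k1 then \<phi> j else if j \<le> k2 then \<phi> j - (s - \<phi> j) / \<rho> else 0)"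
    by (rule optimal_threshold[OF assms(1) dec nonneg assms(2) KN], assumption, assumption, rule that)
  define \<alpha> where "\<alpha> = (\<lambda>j. shrink \<rho> s (\<phi> j))"
  define A where "A = dyad_sum u w (\<lambda>k. \<alpha> (card {..k}))"
  have position: "card {..k} \<in> {1..N}" for k :: 'k
    using bij_betw_apply[OF bij_betw_position, of k] by (simp add: N_def)
  note opt' = opt[OF position, unfolded optimal_weight_def Let_def]
  have argmin: "{A. is_arg_min (prox_objective K \<rho> F) (\<lambda>_. True) A} = {A}"
    unfolding F A_def
  proof (rule prox_objective_arg_min[OF u w assms(1), where t = "\<lambda>k. t (card {..k})" and s = s])
    show "(\<Sum>k\<in>UNIV. t (card {..k :: 'k})) = real K"
      unfolding sum[symmetric] N_def by (rule sum.reindex_bij_betw[OF bij_betw_position])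
    show "0 \<le> t (card {..k})" "t (card {..k}) \<le> 1" for k :: 'k
      using opt' by blast+
    show "\<alpha> (card {..k}) = t (card {..k}) * ((1 + \<rho>) * \<phi> (card {..k}) - \<rho> * \<alpha> (card {..k}))" for k :: 'k
      unfolding \<alpha>_def using opt' by blast
    show "max 0 (((1 + \<rho>) * \<phi> (card {..k}) - \<rho> * \<alpha> (card {..k}))\<^sup>2 - s\<^sup>2)
        \<le> t (card {..k}) * (((1 + \<rho>) * \<phi> (card {..k}) - \<rho> * \<alpha> (card {..k}))\<^sup>2 - s\<^sup>2)" for k :: 'k
      unfolding \<alpha>_def using opt' by blast
  qed
  have "is_arg_min (prox_objective K \<rho> F) (\<lambda>_. True) A"
    using argmin by (simp add: set_eq_iff)
  then have "is_arg_min (prox_objective K \<rho> F) (\<lambda>_. True) (prox_op K \<rho> F)"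
    unfolding prox_op_def arg_min_def by (rule someI)
  then have prox: "prox_op K \<rho> F = A"
    using argmin by (simp add: set_eq_iff)
  have "(norm A)\<^sup>2 \<le> (norm F)\<^sup>2"
    unfolding A_def F norm_sq_dyad_sum[OF u w]
    using nonneg position by (intro sum_mono power_mono) (simp_all add: \<alpha>_def shrink_le shrink_nonneg)
  then have contraction: "norm (prox_op K \<rho> F) \<le> norm F"
    unfolding prox by (rule power2_le_imp_le) simp
  have A: "A = U ** diag_matrix \<alpha> ** conj_transpose V"
    by (simp add: diag_product_eq_dyad_sum A_def u_def w_def)
  have "decreasing_upto N \<alpha>"
    using dec assms(1) by (auto simp: decreasing_upto_def \<alpha>_def intro: shrink_mono)
  moreover have "\<forall>j. 1 \<le> j \<longrightarrow> j \<le> N \<longrightarrow> \<alpha> j \<le> \<phi> j"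
    by (simp add: \<alpha>_def shrink_le)
  moreover have "\<forall>j. 1 \<le> j \<longrightarrow> j \<le> N \<longrightarrow>
      \<alpha> j = (if j < k1 then \<phi> j else if j \<le> k2 then \<phi> j - (s - \<phi> j) / \<rho> else 0)"
    using form by (simp add: \<alpha>_def)
  ultimately show ?thesis
    using k12 contraction unfolding N_def
    by (intro conjI exI[of _ \<alpha>] exI[of _ k1] exI[of _ k2] exI[of _ s] argmin[unfolded A])
qed

end
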